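(* Let $M=P+\epsilon D\in\mathbb{D}\mathbb{H}[t]$ be a bounded, monic motion polynomial and let $R$ be the greatest real polynomial factor of its primal part $P$. Then there exist a real polynomial $Q\in\mathbb{R}[t]$ with $\deg Q\le \deg R$ and linear rotation polynomials $t-h_1,\dots,t-h_n$ such that $QM=(t-h_1)\cdots(t-h_n)$. (In the paper this is stated as: the degree of the real polynomial $Q$ returned by the paper's factorization algorithm, which outputs $Q$ and such a factorization of $QM$, is at most $\deg R$.)
   Context: $\mathbb{H}$ denotes the real quaternions and $\mathbb{D}\mathbb{H}$ the dual quaternions $p+\epsilon q$ ($p,q\in\mathbb{H}$, $\epsilon^2=0$, $\epsilon$ commuting with $\mathbf{i},\mathbf{j},\mathbf{k}$), with conjugation $\overline{p+\epsilon q}=\overline{p}+\epsilon\overline{q}$ (quaternion conjugation negates the $\mathbf{i},\mathbf{j},\mathbf{k}$ coefficients). $\mathbb{D}\mathbb{H}[t]$ is the polynomial ring in $t$ over $\mathbb{D}\mathbb{H}$ with $t$ commuting with coefficients; $\overline{\sum c_it^i}=\sum\overline{c_i}t^i$. Write $M=P+\epsilon D$ with $P,D\in\mathbb{H}[t]$; $P$ is the primal part. $M$ is a motion polynomial if $P\overline{D}+D\overline{P}=0$ and its leading coefficient is invertible; monic if the leading coefficient is $1$; bounded if $P$ has no real zeros. The greatest real polynomial factor of $P\in\mathbb{H}[t]$ is the monic real polynomial of maximal degree dividing $P$ in $\mathbb{H}[t]$; it equals $\gcd(P,\overline{P})$ computed as the greatest real common factor. A linear rotation polynomial is $t-h$ with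 $h=p+\epsilon q$ ($p,q\in\mathbb{H}$) satisfying $q+\overline{q}=0$, $p\overline{q}+q\overline{p}=0$ and $p\notin\mathbb{R}$. *)

theory Defs
  imports "HOL-Computational_Algebra.Polynomial"
begin

datatype quat = Quat (qre: real) (qi: real) (qj: real) (qk: real)

instantiation quat :: ring_1
begin
definition "0 = Quat 0 0 0 0"
definition "1 = Quat 1 0 0 0"
definition "x + y = Quat (qre x + qre y) (qi x + qi y) (qj x + qj y) (qk x + qk y)"
definition "x - y = Quat (qre x - qre y) (qi x - qi y) (qj x - qj y) (qk x - qk y)"
definition "- x = Quat (- qre x) (- qi x) (- qj x) (- qk x)"
definition "x * y = Quat
   (qre x * qre y - qi x * qi y - qj x * qj y - qk x * qk y)
   (qre x * qi y + qi x * qre y + qj x * qk y - qk x * qj y)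
   (qre x * qj y - qi x * qk y + qj x * qre y + qk x * qi y)
   (qre x * qk y + qi x * qj y - qj x * qi y + qk x * qre y)"
instance
  by standard (auto simp: zero_quat_def one_quat_def plus_quat_def minus_quat_def
      uminus_quat_def times_quat_def quat.expand algebra_simps)
end

definition qcnj :: "quat \<Rightarrow> quat" where
  "qcnj x = Quat (qre x) (- qi x) (- qj x) (- qk x)"

definition qof_real :: "real \<Rightarrow> quat" where
  "qof_real r = Quat r 0 0 0"

definition qis_real :: "quat \<Rightarrow> bool" where
  "qis_real x \<longleftrightarrow> (\<exists>r. x = qof_real r)"

datatype dquat = DQ (dprim: quat) (ddual: quat)

instantiation dquat :: ring_1
begin
definition "0 = DQ 0 0"
definition "1 = DQ 1 0"
definition "x + y = DQ (dprim x + dprim y) (ddual x + ddual y)"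
definition "x - y = DQ (dprim x - dprim y) (ddual x - ddual y)"
definition "- x = DQ (- dprim x) (- ddual x)"
definition "x * y = DQ (dprim x * dprim y) (dprim x * ddual y + ddual x * dprim y)"
instance
  by standard (auto simp: zero_dquat_def one_dquat_def plus_dquat_def minus_dquat_def
      uminus_dquat_def times_dquat_def dquat.expand algebra_simps)
end

definition dq_of_real :: "real \<Rightarrow> dquat" where
  "dq_of_real r = DQ (qof_real r) 0"

definition dq_invertible :: "dquat \<Rightarrow> bool" where
  "dq_invertible x \<longleftrightarrow> (\<exists>y. x * y = 1 \<and> y * x = 1)"

text \<open>Product in R[t] for a noncommutative ring R: the indeterminate t commutes
  with the coefficients. Horner-style: (a + t p) q = a q + t (p q).\<close>
definition pmult :: "'a::ring_1 poly \<Rightarrow> 'a poly \<Rightarrow> 'a poly" where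
  "pmult p q = foldr (\<lambda>a r. map_poly ((*) a) q + pCons 0 r) (coeffs p) 0"

definition pprod_list :: "'a::ring_1 poly list \<Rightarrow> 'a poly" where
  "pprod_list ps = foldr pmult ps [:1:]"

definition qpcnj :: "quat poly \<Rightarrow> quat poly" where
  "qpcnj p = map_poly qcnj p"

definition qpeval :: "quat poly \<Rightarrow> real \<Rightarrow> quat" where
  "qpeval p r = (\<Sum>i\<le>degree p. qof_real (r ^ i) * coeff p i)"

definition primal :: "dquat poly \<Rightarrow> quat poly" where
  "primal M = map_poly dprim M"

definition dualpart :: "dquat poly \<Rightarrow> quat poly" where
  "dualpart M = map_poly ddual M"

definition motion_poly :: "dquat poly \<Rightarrow> bool" where
  "motion_poly M \<longleftrightarrow>
     pmult (primal M) (qpcnj (dualpart M)) + pmult (dualpart M) (qpcnj (primal M)) = 0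
     \<and> dq_invertible (lead_coeff M)"

definition monic_dpoly :: "dquat poly \<Rightarrow> bool" where
  "monic_dpoly M \<longleftrightarrow> lead_coeff M = 1"

definition bounded_dpoly :: "dquat poly \<Rightarrow> bool" where
  "bounded_dpoly M \<longleftrightarrow> (\<forall>r::real. qpeval (primal M) r \<noteq> 0)"

definition real_divides :: "real poly \<Rightarrow> quat poly \<Rightarrow> bool" where
  "real_divides R P \<longleftrightarrow> (\<exists>S. P = pmult (map_poly qof_real R) S)"

definition greatest_real_factor :: "real poly \<Rightarrow> quat poly \<Rightarrow> bool" where
  "greatest_real_factor R P \<longleftrightarrow>
     lead_coeff R = 1 \<and> real_divides R P \<and>
     (\<forall>R'. lead_coeff R' = 1 \<and> real_divides R' P \<longrightarrow> degree R' \<le> degree R)"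

text \<open>h = p + \<epsilon> q gives a linear rotation polynomial t - h.\<close>
definition rotation_elem :: "dquat \<Rightarrow> bool" where
  "rotation_elem h \<longleftrightarrow>
     ddual h + qcnj (ddual h) = 0 \<and>
     dprim h * qcnj (ddual h) + ddual h * qcnj (dprim h) = 0 \<and>
     \<not> qis_real (dprim h)"

definition lin_poly :: "dquat \<Rightarrow> dquat poly" where
  "lin_poly h = [:- h, 1:]"

end

theory Submission
  imports Defs
    "HOL-Computational_Algebra.Field_as_Ring"
    "HOL-Computational_Algebra.Polynomial_Factorial"
    "HOL-Computational_Algebra.Fundamental_Theorem_Algebra"
begin

text \<open>
  The induction is on the degree of \<open>M = P + \<epsilon> D\<close> plus the degree of the greatest real factor of \<open>P\<close>.
  Let \<open>m\<close> be an irreducible quadratic factor of the norm polynomial of \<open>P\<close>. If \<open>m\<close> does not divide \<open>P\<close>,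
  division of \<open>M\<close> by \<open>m\<close> leaves a linear remainder whose zero \<open>h\<close> gives a right factor \<open>t - h\<close> of \<open>M\<close>.
  If \<open>m\<close> divides both \<open>P\<close> and the norm of \<open>D\<close>, a quaternionic right factor of \<open>D\<close> is one of \<open>M\<close>.
  In the remaining case \<open>P = m P1\<close>, choose a quaternion \<open>h\<close> with \<open>m = (t - h) (t - hbar)\<close>. Then
  \<open>(t - hbar) D\<close> has a right factor \<open>t - k\<close> of norm \<open>m\<close>, so \<open>(t - hbar) M = M' (t - k)\<close>, where \<open>M'\<close> has the
  degree of \<open>M\<close> and primal part \<open>(t - hbar) P1 (t - kbar)\<close>. For a suitable \<open>h\<close> this has no more real
  factors than \<open>P1\<close>, and a factorization of \<open>Q' M'\<close> gives one of \<open>m Q' M = (t - h) Q' M' (t - k)\<close>.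
\<close>

section \<open>Quaternions over a commutative ring\<close>

text \<open>Since t is central, H[t] is the quaternion algebra over R[t]. In this form the
  noncommutative product of polynomials is an ordinary ring product, and divisibility in R[t] can be
  applied coordinate by coordinate.\<close>

datatype 'a quatn = Quatn (c0: 'a) (c1: 'a) (c2: 'a) (c3: 'a)

instantiation quatn :: (comm_ring_1) ring_1
begin
definition "0 = Quatn 0 0 0 0"
definition "1 = Quatn 1 0 0 0"
definition "x + y = Quatn (c0 x + c0 y) (c1 x + c1 y) (c2 x + c2 y) (c3 x + c3 y)"
definition "x - y = Quatn (c0 x - c0 y) (c1 x - c1 y) (c2 x - c2 y) (c3 x - c3 y)"
definition "- x = Quatn (- c0 x) (- c1 x) (- c2 x) (- c3 x)"
definition "x * y = Quatn
   (c0 x * c0 y - c1 x * c1 y - c2 x * c2 y - c3 x * c3 y)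
   (c0 x * c1 y + c1 x * c0 y + c2 x * c3 y - c3 x * c2 y)
   (c0 x * c2 y - c1 x * c3 y + c2 x * c0 y + c3 x * c1 y)
   (c0 x * c3 y + c1 x * c2 y - c2 x * c1 y + c3 x * c0 y)"
instance
  by standard (auto simp: zero_quatn_def one_quatn_def plus_quatn_def minus_quatn_def
      uminus_quatn_def times_quatn_def quatn.expand algebra_simps)
end

definition qconj :: "'a::comm_ring_1 quatn \<Rightarrow> 'a quatn" where
  "qconj x = Quatn (c0 x) (- c1 x) (- c2 x) (- c3 x)"

definition qnorm :: "'a::comm_ring_1 quatn \<Rightarrow> 'a" where
  "qnorm x = c0 x * c0 x + c1 x * c1 x + c2 x * c2 x + c3 x * c3 x"

definition scal :: "'a::comm_ring_1 \<Rightarrow> 'a quatn" where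
  "scal a = Quatn a 0 0 0"

lemma quatn_sel [simp]:
  "c0 0 = 0" "c1 0 = 0" "c2 0 = 0" "c3 0 = 0"
  "c0 1 = 1" "c1 1 = 0" "c2 1 = 0" "c3 1 = 0"
  "c0 (x + y) = c0 x + c0 y" "c1 (x + y) = c1 x + c1 y"
  "c2 (x + y) = c2 x + c2 y" "c3 (x + y) = c3 x + c3 y"
  "c0 (x - y) = c0 x - c0 y" "c1 (x - y) = c1 x - c1 y"
  "c2 (x - y) = c2 x - c2 y" "c3 (x - y) = c3 x - c3 y"
  "c0 (- x) = - c0 x" "c1 (- x) = - c1 x" "c2 (- x) = - c2 x" "c3 (- x) = - c3 x"
  "c0 (scal a) = a" "c1 (scal a) = 0" "c2 (scal a) = 0" "c3 (scal a) = 0"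
  "c0 (qconj x) = c0 x" "c1 (qconj x) = - c1 x" "c2 (qconj x) = - c2 x" "c3 (qconj x) = - c3 x"
  "c0 (scal a * x) = a * c0 x" "c1 (scal a * x) = a * c1 x"
  "c2 (scal a * x) = a * c2 x" "c3 (scal a * x) = a * c3 x"
  by (simp_all add: zero_quatn_def one_quatn_def plus_quatn_def minus_quatn_def
      uminus_quatn_def times_quatn_def scal_def qconj_def)

lemma quatn_sel_mult:
  "c0 (x * y) = c0 x * c0 y - c1 x * c1 y - c2 x * c2 y - c3 x * c3 y"
  "c1 (x * y) = c0 x * c1 y + c1 x * c0 y + c2 x * c3 y - c3 x * c2 y"
  "c2 (x * y) = c0 x * c2 y - c1 x * c3 y + c2 x * c0 y + c3 x * c1 y"
  "c3 (x * y) = c0 x * c3 y + c1 x * c2 y - c2 x * c1 y + c3 x * c0 y"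
  by (simp_all add: times_quatn_def)

lemma quatn_eqI:
  "c0 x = c0 y \<Longrightarrow> c1 x = c1 y \<Longrightarrow> c2 x = c2 y \<Longrightarrow> c3 x = c3 y \<Longrightarrow> x = y"
  by (simp add: quatn.expand)

lemma qconj_mult: "qconj (x * y) = qconj y * qconj x"
  by (rule quatn_eqI) (simp_all add: quatn_sel_mult algebra_simps)

lemma qconj_add: "qconj (x + y) = qconj x + qconj y"
  by (rule quatn_eqI) simp_all

lemma qconj_qconj [simp]: "qconj (qconj x) = x"
  by (rule quatn_eqI) simp_all

lemma qconj_scal [simp]: "qconj (scal a) = scal a"
  by (rule quatn_eqI) simp_all

lemma mult_qconj: "x * qconj x = scal (qnorm x)"
  by (rule quatn_eqI) (simp_all add: quatn_sel_mult qnorm_def algebra_simps)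

lemma qconj_mult_self: "qconj x * x = scal (qnorm x)"
  by (rule quatn_eqI) (simp_all add: quatn_sel_mult qnorm_def algebra_simps)

lemma qnorm_qconj [simp]: "qnorm (qconj x) = qnorm x"
  by (simp add: qnorm_def)

lemma qnorm_mult: "qnorm (x * y) = qnorm x * qnorm y"
  by (simp add: qnorm_def quatn_sel_mult algebra_simps)

lemma scal_commute: "x * scal a = scal a * x"
  by (rule quatn_eqI) (simp_all add: quatn_sel_mult algebra_simps)

lemma scal_left_commute: "x * (scal a * y) = scal a * (x * y)"
  by (metis mult.assoc scal_commute)

lemma qconj_scal_mult: "qconj (scal a * x) = scal a * qconj x"
  by (rule quatn_eqI) simp_all

lemma scal_mult: "scal (a * b) = scal a * scal b"
  by (rule quatn_eqI) simp_all

lemma scal_1 [simp]: "scal 1 = 1"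
  by (rule quatn_eqI) simp_all

lemma scal_cancel:
  fixes a :: "'a::idom"
  assumes "scal a * x = scal a * y" "a \<noteq> 0"
  shows "x = y"
proof -
  have "c0 (scal a * x) = c0 (scal a * y)" "c1 (scal a * x) = c1 (scal a * y)"
    "c2 (scal a * x) = c2 (scal a * y)" "c3 (scal a * x) = c3 (scal a * y)"
    using assms(1) by simp_all
  with assms(2) show ?thesis by (intro quatn_eqI) simp_all
qed

section \<open>Scalar divisors and content\<close>

definition qdvd :: "'a::comm_ring_1 \<Rightarrow> 'a quatn \<Rightarrow> bool" where
  "qdvd a x \<longleftrightarrow> (\<exists>y. x = scal a * y)"

lemma qdvd_iff: "qdvd a x \<longleftrightarrow> a dvd c0 x \<and> a dvd c1 x \<and> a dvd c2 x \<and> a dvd c3 x"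
proof
  assume "a dvd c0 x \<and> a dvd c1 x \<and> a dvd c2 x \<and> a dvd c3 x"
  then obtain y0 y1 y2 y3 where "c0 x = a * y0" "c1 x = a * y1" "c2 x = a * y2" "c3 x = a * y3"
    by (auto simp: dvd_def)
  then have "x = scal a * Quatn y0 y1 y2 y3"
    by (intro quatn_eqI) simp_all
  then show "qdvd a x" unfolding qdvd_def by blast
qed (auto simp: qdvd_def)

lemma qdvd_mult_left: "qdvd a x \<Longrightarrow> qdvd a (y * x)"
  unfolding qdvd_def by (metis scal_left_commute)

lemma qdvd_mult_right: "qdvd a x \<Longrightarrow> qdvd a (x * y)"
  unfolding qdvd_def by (metis mult.assoc)

text \<open>Over \<open>real poly\<close> this is, up to a unit, the greatest real polynomial
  factor.\<close>

definition content4 :: "'a::{comm_ring_1,semiring_gcd} quatn \<Rightarrow> 'a" where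
  "content4 x = gcd (gcd (c0 x) (c1 x)) (gcd (c2 x) (c3 x))"

lemma qdvd_iff_content: "qdvd a x \<longleftrightarrow> a dvd content4 x"
  by (auto simp: qdvd_iff content4_def)

lemma content4_scal: "content4 (scal a * x) = normalize (a * content4 x)"
  by (simp add: content4_def gcd_mult_left flip: normalize_mult)

lemma content4_eq_0_iff: "content4 x = 0 \<longleftrightarrow> x = 0"
  by (auto simp: content4_def quatn.expand)

section \<open>Dual numbers over a possibly noncommutative ring\<close>

datatype 'a dualn = Dualn (dstd: 'a) (deps: 'a)

instantiation dualn :: (ring_1) ring_1
begin
definition "0 = Dualn 0 0"
definition "1 = Dualn 1 0"
definition "x + y = Dualn (dstd x + dstd y) (deps x + deps y)"
definition "x - y = Dualn (dstd x - dstd y) (deps x - deps y)"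
definition "- x = Dualn (- dstd x) (- deps x)"
definition "x * y = Dualn (dstd x * dstd y) (dstd x * deps y + deps x * dstd y)"
instance
  by standard (auto simp: zero_dualn_def one_dualn_def plus_dualn_def minus_dualn_def
      uminus_dualn_def times_dualn_def dualn.expand algebra_simps)
end

lemma dualn_sel [simp]:
  "dstd 0 = 0" "deps 0 = 0" "dstd 1 = 1" "deps 1 = 0"
  "dstd (x + y) = dstd x + dstd y" "deps (x + y) = deps x + deps y"
  "dstd (x - y) = dstd x - dstd y" "deps (x - y) = deps x - deps y"
  "dstd (- x) = - dstd x" "deps (- x) = - deps x"
  by (simp_all add: zero_dualn_def one_dualn_def plus_dualn_def minus_dualn_def uminus_dualn_def)

lemma dualn_sel_mult:
  "dstd (x * y) = dstd x * dstd y" "deps (x * y) = dstd x * deps y + deps x * dstd y"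
  by (simp_all add: times_dualn_def)

section \<open>Coordinates of quaternions and dual quaternions\<close>

lemma quat_sel [simp]:
  "qre 0 = 0" "qi 0 = 0" "qj 0 = 0" "qk 0 = 0"
  "qre 1 = 1" "qi 1 = 0" "qj 1 = 0" "qk 1 = 0"
  "qre (x + y) = qre x + qre y" "qi (x + y) = qi x + qi y"
  "qj (x + y) = qj x + qj y" "qk (x + y) = qk x + qk y"
  "qre (x - y) = qre x - qre y" "qi (x - y) = qi x - qi y"
  "qj (x - y) = qj x - qj y" "qk (x - y) = qk x - qk y"
  "qre (- x) = - qre x" "qi (- x) = - qi x" "qj (- x) = - qj x" "qk (- x) = - qk x"
  "qof_real 0 = 0" "qcnj 0 = 0" "qre (qof_real a) = a" "qi (qof_real a) = 0" "qj (qof_real a) = 0" "qk (qof_real a) = 0"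
  "qre (qcnj x) = qre x" "qi (qcnj x) = - qi x" "qj (qcnj x) = - qj x" "qk (qcnj x) = - qk x"
  by (simp_all add: zero_quat_def one_quat_def plus_quat_def minus_quat_def
      uminus_quat_def times_quat_def qof_real_def qcnj_def)

lemma quat_sel_mult:
  "qre (x * y) = qre x * qre y - qi x * qi y - qj x * qj y - qk x * qk y"
  "qi (x * y) = qre x * qi y + qi x * qre y + qj x * qk y - qk x * qj y"
  "qj (x * y) = qre x * qj y - qi x * qk y + qj x * qre y + qk x * qi y"
  "qk (x * y) = qre x * qk y + qi x * qj y - qj x * qi y + qk x * qre y"
  by (simp_all add: times_quat_def)

lemma quat_eqI:
  "qre x = qre y \<Longrightarrow> qi x = qi y \<Longrightarrow> qj x = qj y \<Longrightarrow> qk x = qk y \<Longrightarrow> x = y"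
  by (simp add: quat.expand)

lemma dquat_sel [simp]:
  "dprim 0 = 0" "ddual 0 = 0" "dprim 1 = 1" "ddual 1 = 0"
  "dprim (x + y) = dprim x + dprim y" "ddual (x + y) = ddual x + ddual y"
  "dprim (- x) = - dprim x" "ddual (- x) = - ddual x"
  "dprim (x * y) = dprim x * dprim y" "ddual (x * y) = dprim x * ddual y + ddual x * dprim y"
  by (simp_all add: zero_dquat_def one_dquat_def plus_dquat_def uminus_dquat_def times_dquat_def)

lemma quat_inverse_exists:
  assumes "a \<noteq> 0"
  shows "\<exists>b::quat. b * a = 1 \<and> a * b = 1"
proof -
  define n where "n = qre a ^ 2 + qi a ^ 2 + qj a ^ 2 + qk a ^ 2"
  have "\<not> (qre a = 0 \<and> qi a = 0 \<and> qj a = 0 \<and> qk a = 0)"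
    using assms by (auto intro: quat_eqI)
  then have "n \<noteq> 0"
    unfolding n_def
    by (smt (verit) zero_le_power2 power_eq_0_iff)
  define b where "b = Quat (qre a / n) (- qi a / n) (- qj a / n) (- qk a / n)"
  have n: "(qre a ^ 2 + qi a ^ 2 + qj a ^ 2 + qk a ^ 2) / n = 1"
    using \<open>n \<noteq> 0\<close> n_def by simp
  have "b * a = 1" "a * b = 1"
    using n by (auto intro!: quat_eqI simp: quat_sel_mult b_def power2_eq_square algebra_simps
        add_divide_distrib)
  then show ?thesis by blast
qed

section \<open>Quaternion polynomials as quaternions over R[t]\<close>

definition poly_quatn :: "quat poly \<Rightarrow> real poly quatn" where
  "poly_quatn p = Quatn (map_poly qre p) (map_poly qi p) (map_poly qj p) (map_poly qk p)"

definition const_quatn :: "quat \<Rightarrow> real poly quatn" where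
  "const_quatn h = Quatn [:qre h:] [:qi h:] [:qj h:] [:qk h:]"

definition var_quatn :: "real poly quatn" where
  "var_quatn = scal [:0, 1:]"

lemma poly_quatn_sel [simp]:
  "c0 (poly_quatn p) = map_poly qre p" "c1 (poly_quatn p) = map_poly qi p"
  "c2 (poly_quatn p) = map_poly qj p" "c3 (poly_quatn p) = map_poly qk p"
  "c0 (const_quatn h) = [:qre h:]" "c1 (const_quatn h) = [:qi h:]"
  "c2 (const_quatn h) = [:qj h:]" "c3 (const_quatn h) = [:qk h:]"
  by (simp_all add: poly_quatn_def const_quatn_def)

lemma poly_quatn_inj: "poly_quatn p = poly_quatn q \<Longrightarrow> p = q"
  by (auto simp: poly_quatn_def poly_eq_iff coeff_map_poly intro!: quat_eqI)

lemma poly_quatn_0 [simp]: "poly_quatn 0 = 0"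
  by (rule quatn_eqI) simp_all

lemma poly_quatn_add: "poly_quatn (p + q) = poly_quatn p + poly_quatn q"
  by (rule quatn_eqI) (simp_all add: poly_eq_iff coeff_map_poly)

lemma poly_quatn_map_mult: "poly_quatn (map_poly ((*) a) q) = const_quatn a * poly_quatn q"
  by (rule quatn_eqI) (simp_all add: poly_eq_iff coeff_map_poly quat_sel_mult quatn_sel_mult)

lemma poly_quatn_pCons: "poly_quatn (pCons a p) = const_quatn a + var_quatn * poly_quatn p"
  by (rule quatn_eqI) (simp_all add: var_quatn_def map_poly_pCons)

lemma poly_quatn_cnj: "poly_quatn (qpcnj p) = qconj (poly_quatn p)"
  by (rule quatn_eqI) (simp_all add: qpcnj_def poly_eq_iff coeff_map_poly)

lemma poly_quatn_of_real: "poly_quatn (map_poly qof_real R) = scal R"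
  by (rule quatn_eqI) (simp_all add: poly_eq_iff coeff_map_poly)

lemma pmult_0 [simp]: "pmult 0 q = 0"
  by (simp add: pmult_def)

lemma pmult_pCons: "pmult (pCons a p) q = map_poly ((*) a) q + pCons 0 (pmult p q)"
proof -
  have "map_poly ((*) (0::'a)) q = 0" by (simp add: poly_eq_iff coeff_map_poly)
  then show ?thesis by (auto simp: pmult_def cCons_def)
qed

lemma var_quatn_commute: "x * var_quatn = var_quatn * x"
  by (simp add: var_quatn_def scal_commute)

text \<open>Induction along the Horner recursion of \<open>pmult\<close>: the rule (a + t p) q = a q
  + t (p q) is distributivity and associativity in the target ring.\<close>

lemma poly_quatn_pmult: "poly_quatn (pmult p q) = poly_quatn p * poly_quatn q"
proof (induction p)
  case (pCons a p)
  have "const_quatn (0::quat) = 0" by (rule quatn_eqI) simp_all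
  with pCons show ?case
    by (simp add: pmult_pCons poly_quatn_add poly_quatn_map_mult poly_quatn_pCons
        distrib_right mult.assoc)
qed simp

lemma real_divides_iff: "real_divides R P \<longleftrightarrow> qdvd R (poly_quatn P)"
proof
  assume "qdvd R (poly_quatn P)"
  then obtain y where y: "poly_quatn P = scal R * y" by (auto simp: qdvd_def)
  \<comment> \<open>The cofactor is reassembled from the coefficients of the four coordinate
    quotients; \<open>Abs_poly\<close> applies because almost all of them vanish
    simultaneously.\<close>
  define S where "S = Abs_poly (\<lambda>i. Quat (coeff (c0 y) i) (coeff (c1 y) i) (coeff (c2 y) i) (coeff (c3 y) i))"
  have ev: "\<forall>\<^sub>\<infinity>i. Quat (coeff (c0 y) i) (coeff (c1 y) i) (coeff (c2 y) i) (coeff (c3 y) i) = 0"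
    using MOST_coeff_eq_0[of "c0 y"] MOST_coeff_eq_0[of "c1 y"]
      MOST_coeff_eq_0[of "c2 y"] MOST_coeff_eq_0[of "c3 y"]
    by eventually_elim (simp add: zero_quat_def)
  have "poly_quatn S = y"
    by (rule quatn_eqI)
      (simp_all add: S_def poly_eq_iff coeff_map_poly Abs_poly_inverse ev)
  then have "poly_quatn P = poly_quatn (pmult (map_poly qof_real R) S)"
    using y by (simp add: poly_quatn_pmult poly_quatn_of_real)
  then show "real_divides R P" unfolding real_divides_def using poly_quatn_inj by blast
qed (auto simp: real_divides_def qdvd_def poly_quatn_pmult poly_quatn_of_real)

section \<open>Dual quaternion polynomials as dual numbers\<close>

definition poly_dualn :: "dquat poly \<Rightarrow> real poly quatn dualn" where
  "poly_dualn M = Dualn (poly_quatn (primal M)) (poly_quatn (dualpart M))"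

definition lin_dualn :: "dquat \<Rightarrow> real poly quatn dualn" where
  "lin_dualn h = Dualn (var_quatn - const_quatn (dprim h)) (- const_quatn (ddual h))"

lemma poly_dualn_inj: "poly_dualn p = poly_dualn q \<Longrightarrow> p = q"
  by (auto simp: poly_dualn_def primal_def dualpart_def dest!: poly_quatn_inj)
    (auto simp: poly_eq_iff coeff_map_poly dquat.expand)

lemma poly_dualn_pmult: "poly_dualn (pmult p q) = poly_dualn p * poly_dualn q"
proof -
  have pr: "primal (p + q) = primal p + primal q" "dualpart (p + q) = dualpart p + dualpart q"
    "primal (pCons a p) = pCons (dprim a) (primal p)"
    "dualpart (pCons a p) = pCons (ddual a) (dualpart p)"
    "primal (map_poly ((*) a) p) = map_poly ((*) (dprim a)) (primal p)"
    "dualpart (map_poly ((*) a) p) =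
      map_poly ((*) (dprim a)) (dualpart p) + map_poly ((*) (ddual a)) (primal p)" for p q a
    by (simp_all add: primal_def dualpart_def poly_eq_iff coeff_map_poly coeff_pCons split: nat.splits)
  have c0: "const_quatn (0::quat) = 0" by (rule quatn_eqI) simp_all
  show ?thesis
  proof (induction p)
    case 0
    then show ?case
      by (simp add: poly_dualn_def primal_def dualpart_def dualn.expand dualn_sel_mult)
  next
    case (pCons a p)
    then show ?case
      by (simp add: pmult_pCons poly_dualn_def pr poly_quatn_add poly_quatn_map_mult
          poly_quatn_pCons distrib_right distrib_left mult.assoc dualn.expand times_dualn_def c0)
  qed
qed

lemma poly_dualn_lin: "poly_dualn (lin_poly h) = lin_dualn h"
proof -
  have "const_quatn (0::quat) = 0" "const_quatn (1::quat) = 1" "const_quatn (-x) = - const_quatn x" for x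
    by (rule quatn_eqI; simp)+
  then show ?thesis
    by (simp add: poly_dualn_def lin_dualn_def lin_poly_def primal_def dualpart_def map_poly_pCons
        poly_quatn_pCons)
qed

lemma poly_dualn_of_real: "poly_dualn (map_poly dq_of_real Q) = Dualn (scal Q) 0"
proof -
  have "primal (map_poly dq_of_real Q) = map_poly qof_real Q" "dualpart (map_poly dq_of_real Q) = 0"
    by (auto simp: primal_def dualpart_def poly_eq_iff coeff_map_poly dq_of_real_def
        zero_dquat_def zero_quat_def qof_real_def)
  then show ?thesis by (simp add: poly_dualn_def poly_quatn_of_real)
qed

lemma poly_dualn_prod: "poly_dualn (pprod_list (map lin_poly hs)) = prod_list (map lin_dualn hs)"
proof (induction hs)
  case Nil
  have "poly_quatn [:1:] = 1" by (rule quatn_eqI) (simp_all add: map_poly_pCons)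
  then show ?case
    by (simp add: pprod_list_def poly_dualn_def primal_def dualpart_def map_poly_pCons one_dualn_def)
next
  case (Cons h hs)
  then show ?case by (simp add: pprod_list_def poly_dualn_pmult poly_dualn_lin)
qed

section \<open>Irreducible real quadratics\<close>

text \<open>This is (t - \<alpha>)^2 + \<beta>^2, with zeros \<alpha> \<plusminus> \<beta> i. It is
  also the norm of t - h for every quaternion h with real part \<alpha> and vector part of length
  |\<beta>|.\<close>

definition quadr :: "real \<Rightarrow> real \<Rightarrow> real poly" where
  "quadr \<alpha> \<beta> = [:\<alpha>\<^sup>2 + \<beta>\<^sup>2, - 2 * \<alpha>, 1:]"

lemma quadr_simps [simp]:
  "degree (quadr \<alpha> \<beta>) = 2" "quadr \<alpha> \<beta> \<noteq> 0" "lead_coeff (quadr \<alpha> \<beta>) = 1"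
  by (simp_all add: quadr_def)

lemma poly_quadr_pos: "\<beta> \<noteq> 0 \<Longrightarrow> poly (quadr \<alpha> \<beta>) r > 0"
proof -
  assume "\<beta> \<noteq> 0"
  then have "(r - \<alpha>)\<^sup>2 + \<beta>\<^sup>2 > 0" by (simp add: add_nonneg_pos)
  then show ?thesis by (simp add: quadr_def power2_eq_square algebra_simps)
qed

definition cpoly :: "real poly \<Rightarrow> complex poly" where
  "cpoly = map_poly complex_of_real"

lemma cpoly_pCons [simp]: "cpoly (pCons a p) = pCons (of_real a) (cpoly p)"
  by (simp add: cpoly_def map_poly_pCons)

lemma cpoly_0 [simp]: "cpoly 0 = 0"
  by (simp add: cpoly_def)

lemma cpoly_add [simp]: "cpoly (p + q) = cpoly p + cpoly q"
  by (simp add: cpoly_def poly_eq_iff coeff_map_poly)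

lemma cpoly_mult [simp]: "cpoly (p * q) = cpoly p * cpoly q"
proof (induction p)
  case (pCons a p)
  have "cpoly (smult a q) = smult (of_real a) (cpoly q)"
    by (simp add: cpoly_def poly_eq_iff coeff_map_poly)
  with pCons show ?case by simp
qed simp

text \<open>The remainder a + b t takes at \<alpha> + \<beta> i a value with imaginary part b
  \<beta>, so it vanishes there only if a = b = 0.\<close>

lemma quadr_dvd_iff:
  assumes "\<beta> \<noteq> 0"
  shows "quadr \<alpha> \<beta> dvd f \<longleftrightarrow> poly (cpoly f) (Complex \<alpha> \<beta>) = 0"
proof -
  let ?m = "quadr \<alpha> \<beta>" and ?z = "Complex \<alpha> \<beta>"
  have root: "poly (cpoly ?m) ?z = 0"
    by (simp add: quadr_def complex_eq_iff power2_eq_square algebra_simps)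
  have "degree (f mod ?m) < 2"
    using degree_mod_less'[of ?m f] by fastforce
  then obtain a b where ab: "f mod ?m = [:a, b:]"
    by (metis degree_eq_zeroE degree_pCons_eq_if less_2_cases_iff pCons_cases nat.inject
        numeral_2_eq_2 pCons_0_0 Suc_less_eq less_Suc0)
  have "cpoly f = cpoly (?m * (f div ?m) + f mod ?m)" by simp
  then have "poly (cpoly f) ?z = of_real a + ?z * of_real b"
    unfolding cpoly_add cpoly_mult ab using root by simp
  also have "\<dots> = 0 \<longleftrightarrow> a = 0 \<and> b = 0"
    using assms by (auto simp: complex_eq_iff)
  also have "\<dots> \<longleftrightarrow> ?m dvd f"
    by (simp add: dvd_eq_mod_eq_0 ab)
  finally show ?thesis by simp
qed

text \<open>Divisibility is vanishing at one complex point, and evaluation there is multiplicative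
  with values in a field.\<close>

lemma prime_elem_quadr:
  assumes "\<beta> \<noteq> 0"
  shows "prime_elem (quadr \<alpha> \<beta>)"
  unfolding prime_elem_def
  using assms by (auto simp: quadr_dvd_iff poly_eq_0_iff_dvd is_unit_iff_degree)

text \<open>The fundamental theorem of algebra gives a complex zero, which is not real by
  hypothesis.\<close>

lemma exists_quadr_factor:
  assumes "degree f > 0" "\<And>r. poly f r \<noteq> 0"
  shows "\<exists>\<alpha> \<beta>. \<beta> \<noteq> 0 \<and> quadr \<alpha> \<beta> dvd f"
proof -
  have "degree (cpoly f) = degree f"
    unfolding cpoly_def by (rule degree_map_poly) simp
  then have "\<not> constant (poly (cpoly f))"
    using assms(1) by (simp add: constant_degree)
  then obtain z where z: "poly (cpoly f) z = 0"
    using fundamental_theorem_of_algebra by blast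
  have real: "poly (cpoly f) (of_real r) = of_real (poly f r)" for r
    by (induction f) simp_all
  have "Im z \<noteq> 0"
  proof
    assume "Im z = 0"
    then have "z = of_real (Re z)" by (simp add: complex_eq_iff)
    with z real have "poly f (Re z) = 0" by (metis of_real_eq_0_iff)
    with assms(2) show False by blast
  qed
  moreover have "z = Complex (Re z) (Im z)" by simp
  ultimately show ?thesis using z quadr_dvd_iff by metis
qed

section \<open>Norms, linear polynomials and remainders modulo a quadratic\<close>

text \<open>At each real point the norm is a sum of four real squares, so all coordinates vanish at
  every point.\<close>

lemma qnorm_real_poly_eq_0:
  fixes x :: "real poly quatn"
  assumes "qnorm x = 0"
  shows "x = 0"
proof -
  have "poly (c0 x) r = 0 \<and> poly (c1 x) r = 0 \<and> poly (c2 x) r = 0 \<and> poly (c3 x) r = 0" for r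
  proof -
    have "poly (qnorm x) r = 0" using assms by simp
    then have "poly (c0 x) r * poly (c0 x) r + poly (c1 x) r * poly (c1 x) r
        + poly (c2 x) r * poly (c2 x) r + poly (c3 x) r * poly (c3 x) r = 0"
      by (simp add: qnorm_def)
    then show ?thesis
      by (smt (verit) zero_le_square mult_eq_0_iff)
  qed
  then show ?thesis by (intro quatn_eqI) (simp_all flip: poly_all_0_iff_0)
qed

lemma qconj_diff: "qconj (x - y) = qconj x - qconj y"
  by (rule quatn_eqI) simp_all

lemma const_quatn_mult: "const_quatn (a * b) = const_quatn a * const_quatn b"
  by (rule quatn_eqI) (simp_all add: quat_sel_mult quatn_sel_mult)

lemma const_quatn_add: "const_quatn (a + b) = const_quatn a + const_quatn b"
  by (rule quatn_eqI) simp_all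

lemma const_quatn_minus: "const_quatn (- a) = - const_quatn a"
  by (rule quatn_eqI) simp_all

lemma const_quatn_0 [simp]: "const_quatn 0 = 0"
  by (rule quatn_eqI) simp_all

lemma const_quatn_1 [simp]: "const_quatn 1 = 1"
  by (rule quatn_eqI) simp_all

lemma qconj_const: "qconj (const_quatn a) = const_quatn (qcnj a)"
  by (rule quatn_eqI) simp_all

lemma qconj_var [simp]: "qconj var_quatn = var_quatn"
  by (simp add: var_quatn_def)

definition lin_quatn :: "quat \<Rightarrow> real poly quatn" where
  "lin_quatn k = var_quatn - const_quatn k"

lemma qconj_lin: "qconj (lin_quatn k) = lin_quatn (qcnj k)"
  by (rule quatn_eqI) (simp_all add: lin_quatn_def var_quatn_def)

lemma qnorm_lin_Quat:
  "qnorm (lin_quatn (Quat \<alpha> x y z)) = [:\<alpha>\<^sup>2 + x\<^sup>2 + y\<^sup>2 + z\<^sup>2, - 2 * \<alpha>, 1:]"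
  by (simp add: qnorm_def lin_quatn_def var_quatn_def power2_eq_square)

text \<open>Provides the last condition of \<open>rotation_elem\<close>: a real k would be a zero of
  its own norm polynomial, which is positive on the reals.\<close>

lemma lin_not_real:
  assumes "qnorm (lin_quatn k) = quadr \<alpha> \<beta>" "\<beta> \<noteq> 0"
  shows "\<not> qis_real k"
proof
  assume "qis_real k"
  then obtain r where "k = Quat r 0 0 0" by (auto simp: qis_real_def qof_real_def)
  then have "poly (quadr \<alpha> \<beta>) r = 0"
    using assms(1) by (simp add: qnorm_lin_Quat power2_eq_square flip: assms(1))
  then show False using poly_quadr_pos[OF assms(2), of \<alpha> r] by simp
qed

lemma quatn_mod_quadr:
  fixes P :: "real poly quatn"
  shows "\<exists>T b e. P = scal (quadr \<alpha> \<beta>) * T + (const_quatn b * var_quatn + const_quatn e)"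
proof -
  let ?m = "quadr \<alpha> \<beta>"
  have "\<exists>b e. f = ?m * (f div ?m) + [:e, b:]" for f
  proof -
    have "degree (f mod ?m) < 2"
      using degree_mod_less'[of ?m f] by fastforce
    then have "f mod ?m = [:coeff (f mod ?m) 0, coeff (f mod ?m) 1:]"
      by (auto simp: poly_eq_iff coeff_pCons coeff_eq_0 split: nat.splits)
    then show ?thesis by (metis mult_div_mod_eq)
  qed
  then obtain b e where be: "\<And>f. f = ?m * (f div ?m) + [:e f, b f:]" by metis
  have "P = scal ?m * Quatn (c0 P div ?m) (c1 P div ?m) (c2 P div ?m) (c3 P div ?m)
      + (const_quatn (Quat (b (c0 P)) (b (c1 P)) (b (c2 P)) (b (c3 P))) * var_quatn
        + const_quatn (Quat (e (c0 P)) (e (c1 P)) (e (c2 P)) (e (c3 P))))"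
    using be[of "c0 P"] be[of "c1 P"] be[of "c2 P"] be[of "c3 P"]
    by (intro quatn_eqI) (simp_all add: var_quatn_def scal_commute)
  then show ?thesis by blast
qed

lemma qdvd_add: "qdvd a x \<Longrightarrow> qdvd a y \<Longrightarrow> qdvd a (x + y)"
  by (auto simp: qdvd_iff)

lemma qdvd_diff: "qdvd a x \<Longrightarrow> qdvd a y \<Longrightarrow> qdvd a (x - y)"
  by (auto simp: qdvd_iff)

lemma qdvd_scal [simp]: "qdvd a (scal a * x)" "qdvd a (scal a)"
  by (auto simp: qdvd_iff)

lemma qdvd_qconj: "qdvd a x \<Longrightarrow> qdvd a (qconj x)"
  by (auto simp: qdvd_iff)

lemma qdvd_cancel:
  fixes x :: "real poly quatn"
  assumes "b * a = 1" "qdvd m (const_quatn a * x)"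
  shows "qdvd m x"
proof -
  have "const_quatn b * (const_quatn a * x) = x"
    using assms(1) by (simp flip: mult.assoc const_quatn_mult)
  with qdvd_mult_left[OF assms(2)] show ?thesis by metis
qed

text \<open>Modulo the quadratic \<open>m\<close>, a polynomial whose norm is divisible by \<open>m\<close> is congruent
  to some \<open>a t + b\<close>, whose norm is then a constant multiple of \<open>m\<close>;
  the zero of \<open>a t + b\<close> is the zero sought.\<close>

lemma linear_mod_quadr:
  assumes "\<beta> \<noteq> 0" "quadr \<alpha> \<beta> dvd qnorm P"
  shows "\<exists>T a k. P = scal (quadr \<alpha> \<beta>) * T + const_quatn a * lin_quatn k
    \<and> qnorm (lin_quatn k) = quadr \<alpha> \<beta>"
proof -
  let ?m = "quadr \<alpha> \<beta>"
  obtain T a e where P: "P = scal ?m * T + (const_quatn a * var_quatn + const_quatn e)"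
    using quatn_mod_quadr by blast
  define S where "S = const_quatn a * var_quatn + const_quatn e"
  \<comment> \<open>Replacing P by its remainder S changes \<open>P * qconj P\<close> only by
    multiples of the quadratic.\<close>
  have "S * qconj S = P * qconj P - scal ?m * T * qconj P - S * qconj (scal ?m * T)"
    by (simp add: P qconj_add distrib_left distrib_right flip: S_def)
  moreover have "qdvd ?m (P * qconj P)"
    using assms(2) by (simp add: mult_qconj qdvd_iff)
  moreover have "qdvd ?m (scal ?m * T * qconj P)" "qdvd ?m (S * qconj (scal ?m * T))"
    by (intro qdvd_mult_left[OF qdvd_qconj] qdvd_mult_right qdvd_scal)+
  ultimately have "qdvd ?m (S * qconj S)" by (metis qdvd_diff)
  then have "?m dvd qnorm S"
    by (simp add: mult_qconj qdvd_iff)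
  then obtain s where s: "qnorm S = ?m * s" by (rule dvdE)
  define c where "c = qre a * qre a + qi a * qi a + qj a * qj a + qk a * qk a"
  have S: "qnorm S = [:qre e * qre e + qi e * qi e + qj e * qj e + qk e * qk e,
      2 * (qre a * qre e + qi a * qi e + qj a * qj e + qk a * qk e), c:]"
    by (simp add: S_def qnorm_def var_quatn_def scal_commute c_def algebra_simps)
  have "degree (qnorm S) \<le> 2" by (simp add: S)
  then have "degree s = 0"
    using s by (cases "s = 0") (simp_all add: degree_mult_eq)
  then obtain s0 where s0: "s = [:s0:]" by (rule degree_eq_zeroE)
  \<comment> \<open>Comparing coefficients of t^2 identifies the constant quotient as the norm of
    a.\<close>
  have "coeff (qnorm S) 2 = s0"
    by (simp add: s s0 quadr_def numeral_2_eq_2)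
  then have "s0 = c" by (simp add: S numeral_2_eq_2)
  then have nS: "qnorm S = ?m * [:c:]" using s s0 by simp
  show ?thesis
  proof (cases "a = 0")
    case True
    then have "qnorm S = 0" by (simp add: nS c_def)
    then have "S = 0" by (rule qnorm_real_poly_eq_0)
    \<comment> \<open>The remainder is zero, so any k of the right norm will do; \<alpha> + \<beta>
      i is one.\<close>
    then have "P = scal ?m * T + const_quatn 0 * lin_quatn (Quat \<alpha> \<beta> 0 0)"
      using P by (simp add: S_def)
    moreover have "qnorm (lin_quatn (Quat \<alpha> \<beta> 0 0)) = ?m"
      by (simp add: qnorm_lin_Quat quadr_def)
    ultimately show ?thesis by blast
  next
    case False
    then obtain b where b: "b * a = 1" "a * b = 1" using quat_inverse_exists by blast
    \<comment> \<open>The zero of a t + e.\<close>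
    define k where "k = - (b * e)"
    have "const_quatn a * const_quatn k = - const_quatn e"
      using b by (simp add: k_def flip: const_quatn_mult const_quatn_minus mult.assoc)
    then have Sk: "S = const_quatn a * lin_quatn k"
      by (simp add: S_def lin_quatn_def right_diff_distrib)
    have "qnorm (const_quatn a) = [:c:]"
      by (simp add: qnorm_def c_def)
    then have "[:c:] * qnorm (lin_quatn k) = [:c:] * ?m"
      using nS by (simp only: Sk qnorm_mult mult.commute)
    moreover have "[:c:] \<noteq> 0"
      using qnorm_real_poly_eq_0[of "const_quatn a"] \<open>qnorm (const_quatn a) = [:c:]\<close> False
      by (metis const_quatn_mult b(2) const_quatn_1 mult_zero_left quatn_sel(1,5) zero_neq_one)
    ultimately have "qnorm (lin_quatn k) = ?m" by (metis mult_cancel_left)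
    then show ?thesis using P Sk S_def by metis
  qed
qed

section \<open>Linear right factors\<close>

text \<open>As m = (t - kbar) (t - k), the multiple of m in the division also has the right factor t
  - k.\<close>

lemma right_factor:
  assumes "\<beta> \<noteq> 0" "quadr \<alpha> \<beta> dvd qnorm P"
  shows "\<exists>P' k. P = P' * lin_quatn k \<and> qnorm (lin_quatn k) = quadr \<alpha> \<beta>"
proof -
  obtain T a k where P: "P = scal (quadr \<alpha> \<beta>) * T + const_quatn a * lin_quatn k"
    and k: "qnorm (lin_quatn k) = quadr \<alpha> \<beta>"
    using linear_mod_quadr[OF assms] by blast
  have "P = (T * qconj (lin_quatn k) + const_quatn a) * lin_quatn k"
    by (simp add: P distrib_right mult.assoc qconj_mult_self k scal_commute)
  with k show ?thesis by blast
qed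

text \<open>Because m does not divide P, the remainder of P is a (t - k) with a invertible. Modulo m
  the polynomial P + \<epsilon> D is then (a + \<epsilon> b) (t - k - \<epsilon> l), and the Study
  condition modulo m forces the rotation conditions on l.\<close>

lemma dual_right_factor:
  assumes "\<beta> \<noteq> 0" "quadr \<alpha> \<beta> dvd qnorm P" "\<not> qdvd (quadr \<alpha> \<beta>) P"
    and study: "P * qconj D + D * qconj P = 0"
  shows "\<exists>P' D' k l. P = P' * lin_quatn k \<and> D = D' * lin_quatn k - P' * const_quatn l
    \<and> qnorm (lin_quatn k) = quadr \<alpha> \<beta>
    \<and> l + qcnj l = 0 \<and> k * qcnj l + l * qcnj k = 0"
proof -
  let ?m = "quadr \<alpha> \<beta>"
  obtain T a k where P: "P = scal ?m * T + const_quatn a * lin_quatn k"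
    and k: "qnorm (lin_quatn k) = ?m"
    using linear_mod_quadr[OF assms(1,2)] by blast
  have "a \<noteq> 0" using assms(3) P by auto
  then obtain a' where a': "a' * a = 1" "a * a' = 1" using quat_inverse_exists by blast
  obtain T1 b e where D: "D = scal ?m * T1 + (const_quatn b * var_quatn + const_quatn e)"
    using quatn_mod_quadr by blast
  \<comment> \<open>Chosen so that b t + e = b (t - k) - a l.\<close>
  define l where "l = - (a' * (e + b * k))"
  define L where "L = lin_quatn k"
  define A where "A = const_quatn a"
  define B where "B = const_quatn b"
  define K where "K = const_quatn l"
  have LL: "L * (qconj L * x) = scal ?m * x" "qconj L * (L * x) = scal ?m * x"
    "L * qconj L = scal ?m" "qconj L * L = scal ?m" for x
    using k by (simp_all add: L_def mult_qconj qconj_mult_self flip: mult.assoc)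
  have "a * l = - (e + b * k)"
    using a' by (simp add: l_def flip: mult.assoc)
  then have "A * K = - (const_quatn e + B * const_quatn k)"
    by (simp add: A_def K_def B_def flip: const_quatn_mult const_quatn_add const_quatn_minus)
  then have D1: "D = scal ?m * T1 + (B * L - A * K)"
    by (simp add: D L_def lin_quatn_def right_diff_distrib B_def)
  have P1: "P = scal ?m * T + A * L" by (simp add: P A_def L_def)
  define W where "W = L * qconj K + K * qconj L"
  define D0 where "D0 = B * L - A * K"
  \<comment> \<open>The Study expression of the remainders; it is divisible by m because that of P
    and D is zero.\<close>
  define E where "E = A * L * qconj D0 + D0 * qconj (A * L)"
  have "E = (P * qconj D + D * qconj P) - (scal ?m * T * qconj D
      + A * L * qconj (scal ?m * T1) + scal ?m * T1 * qconj P + D0 * qconj (scal ?m * T))"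
    unfolding E_def D1 P1 D0_def[symmetric] qconj_add by (simp add: algebra_simps)
  then have "E = 0 - (scal ?m * T * qconj D
      + A * L * qconj (scal ?m * T1) + scal ?m * T1 * qconj P + D0 * qconj (scal ?m * T))"
    unfolding study .
  moreover have "qdvd ?m (scal ?m * T * qconj D
      + A * L * qconj (scal ?m * T1) + scal ?m * T1 * qconj P + D0 * qconj (scal ?m * T))"
    by (intro qdvd_add qdvd_mult_left[OF qdvd_qconj] qdvd_mult_right qdvd_scal)
  moreover have "qdvd ?m 0" by (simp add: qdvd_iff)
  ultimately have E: "qdvd ?m E" by (metis qdvd_diff)
  \<comment> \<open>Up to multiples of m, E is - A W Abar. The invertible a is cancelled on the
    left, then on the right after conjugation.\<close>
  have "A * (W * qconj A) = scal ?m * (A * qconj B + B * qconj A) - E"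
    by (simp add: E_def D0_def W_def qconj_mult qconj_diff algebra_simps LL scal_left_commute)
  with E have "qdvd ?m (A * (W * qconj A))" by (auto intro: qdvd_diff)
  then have "qdvd ?m (W * qconj A)"
    unfolding A_def using qdvd_cancel a' by blast
  then have "qdvd ?m (A * qconj W)"
    using qdvd_qconj by (fastforce simp: qconj_mult)
  then have "qdvd ?m (qconj W)"
    unfolding A_def using qdvd_cancel a' by blast
  then have W: "qdvd ?m W" using qdvd_qconj by fastforce
  \<comment> \<open>W has degree at most one, so divisibility by a quadratic makes both its
    coefficients zero.\<close>
  have W': "W = var_quatn * const_quatn (l + qcnj l) - const_quatn (k * qcnj l + l * qcnj k)"
    by (simp add: W_def L_def lin_quatn_def K_def qconj_lin[unfolded lin_quatn_def] qconj_const
        const_quatn_add const_quatn_mult algebra_simps var_quatn_commute)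
  have deg: "x = 0 \<and> y = 0" if "?m dvd [:x, y:]" for x y
  proof (rule ccontr)
    assume "\<not> ?thesis"
    then have "degree ?m \<le> degree [:x, y:]"
      using that by (intro dvd_imp_degree_le) auto
    then show False by (simp split: if_splits)
  qed
  define u where "u = l + qcnj l"
  define v where "v = k * qcnj l + l * qcnj k"
  have "u = 0 \<and> v = 0"
    using W deg[of "- qre v" "qre u"] deg[of "- qi v" "qi u"]
      deg[of "- qj v" "qj u"] deg[of "- qk v" "qk u"]
    unfolding W' u_def[symmetric] v_def[symmetric] qdvd_iff
    by (auto simp: var_quatn_def intro!: quat_eqI)
  then have l: "l + qcnj l = 0" "k * qcnj l + l * qcnj k = 0"
    by (simp_all add: u_def v_def)
  have "W = 0" by (simp add: W' l)
  \<comment> \<open>W = 0 and lbar = - l give L K = K Lbar; substituting Lbar = 2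
    \<open>c0 L\<close> - L turns this into the swapped relation.\<close>
  have LK: "qconj L * K = K * L"
  proof -
    have s: "qconj L = scal (2 * c0 L) - L" by (rule quatn_eqI) simp_all
    have "qcnj l = - l" using l(1) by (simp add: eq_neg_iff_add_eq_0 add.commute)
    then have "qconj K = - K" by (simp add: K_def qconj_const const_quatn_minus)
    with \<open>W = 0\<close> have "L * K = K * qconj L" by (simp add: W_def)
    then show ?thesis by (simp add: s algebra_simps scal_commute)
  qed
  define P' where "P' = T * qconj L + A"
  \<comment> \<open>The summand T K compensates for T Lbar K = T K L, which arises in P' K.\<close>
  define D' where "D' = T1 * qconj L + B + T * K"
  have "P = P' * L"
    by (simp add: P1 P'_def distrib_right mult.assoc LL scal_commute)
  moreover have "D' * L = scal ?m * T1 + B * L + T * (K * L)"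
    by (simp add: D'_def distrib_right mult.assoc LL scal_commute)
  then have "D = D' * L - P' * K"
    by (simp add: D1 P'_def distrib_right mult.assoc LK)
  ultimately show ?thesis using l k unfolding L_def K_def by blast
qed

section \<open>Transferring a linear factor across the dual part\<close>

text \<open>Only the choices \<open>h = \<alpha> \<plusminus> \<beta> i\<close> and \<open>h = \<alpha> \<plusminus> \<beta> j\<close> are needed: for \<open>h = \<alpha> \<plusminus> \<beta> i\<close> the product is
  congruent to \<open>2 \<beta> ((- \<beta> v2 \<mp> (t - \<alpha>) v3) j + (- \<beta> v3 \<pm> (t - \<alpha>) v2) k)\<close>.\<close>

lemma exists_conjugator:
  fixes V :: "real poly quatn"
  assumes "\<beta> \<noteq> 0" "\<not> qdvd (quadr \<alpha> \<beta>) V" "c0 V = 0"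
  shows "\<exists>h. qnorm (lin_quatn h) = quadr \<alpha> \<beta>
    \<and> \<not> qdvd (quadr \<alpha> \<beta>) (lin_quatn (qcnj h) * V * lin_quatn h)"
proof (rule ccontr)
  assume "\<not> ?thesis"
  then have all: "qdvd (quadr \<alpha> \<beta>) (lin_quatn (qcnj h) * V * lin_quatn h)"
    if "qnorm (lin_quatn h) = quadr \<alpha> \<beta>" for h using that by blast
  let ?m = "quadr \<alpha> \<beta>"
  define s where "s = [:- \<alpha>, 1:]"
  define b where "b = [:\<beta>:]"
  have m: "?m = s * s + b * b"
    by (simp add: s_def b_def quadr_def power2_eq_square)
  have "is_unit b" using assms(1) by (simp add: b_def is_unit_iff_degree)
  moreover have "is_unit (4 :: real poly)" by (simp add: is_unit_iff_degree)
  ultimately have unit: "?m dvd f" if "?m dvd 4 * (b * (b * f))" for f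
    using that by (simp add: dvd_mult_unit_iff')
  have lin: "c0 (lin_quatn (Quat \<alpha> x y z)) = s" "c1 (lin_quatn (Quat \<alpha> x y z)) = [:- x:]"
    "c2 (lin_quatn (Quat \<alpha> x y z)) = [:- y:]" "c3 (lin_quatn (Quat \<alpha> x y z)) = [:- z:]" for x y z
    by (simp_all add: lin_quatn_def var_quatn_def s_def)
  have b': "[:- \<beta>:] = - b" "[:\<beta>:] = b" by (simp_all add: b_def)
  have q: "qcnj (Quat \<alpha> x y z) = Quat \<alpha> (- x) (- y) (- z)" for x y z
    by (simp add: qcnj_def)
  define X where "X x y = lin_quatn (qcnj (Quat \<alpha> x y 0)) * V * lin_quatn (Quat \<alpha> x y 0)" for x y
  have X: "qdvd ?m (X \<beta> 0)" "qdvd ?m (X (- \<beta>) 0)" "qdvd ?m (X 0 \<beta>)" "qdvd ?m (X 0 (- \<beta>))"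
    unfolding X_def by (rule all; simp add: qnorm_lin_Quat quadr_def)+
  have step: "?m dvd f" if "x + y + 4 * (b * (b * f)) = ?m * (2 * f)" "?m dvd x" "?m dvd y" for x y f
  proof (rule unit)
    have "4 * (b * (b * f)) = ?m * (2 * f) - (x + y)" using that(1) by (simp add: algebra_simps)
    then show "?m dvd 4 * (b * (b * f))" using that(2,3) by simp
  qed
  \<comment> \<open>Adding the two signs cancels the terms with t - \<alpha> and leaves - 4
    \<beta>^2 times a coordinate of V modulo m. The choices along i yield \<open>c2\<close> and
    \<open>c3\<close>, those along j yield \<open>c1\<close>.\<close>
  have "c2 (X \<beta> 0) + c2 (X (- \<beta>) 0) + 4 * (b * (b * c2 V)) = ?m * (2 * c2 V)"
    "c3 (X \<beta> 0) + c3 (X (- \<beta>) 0) + 4 * (b * (b * c3 V)) = ?m * (2 * c3 V)"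
    "c1 (X 0 \<beta>) + c1 (X 0 (- \<beta>)) + 4 * (b * (b * c1 V)) = ?m * (2 * c1 V)"
    unfolding X_def q quatn_sel_mult lin m assms(3) minus_minus b' minus_zero pCons_0_0
    by (simp_all add: algebra_simps)
  then have "?m dvd c1 V \<and> ?m dvd c2 V \<and> ?m dvd c3 V"
    using X step unfolding qdvd_iff by blast
  then show False using assms(2,3) by (simp add: qdvd_iff)
qed

lemma degree_normalize_poly: "degree (normalize f) = degree (f :: real poly)"
  by (cases "f = 0") (auto intro!: antisym dvd_imp_degree_le)

lemma qdvd_prime_cancel:
  assumes "prime_elem m" "qdvd m (scal a * x)" "\<not> m dvd a"
  shows "qdvd m x"
  using assms by (auto simp: qdvd_iff prime_elem_dvd_mult_iff)

text \<open>Write \<open>P1 = g P2\<close> with \<open>g\<close> real of maximal degree. The linear factor \<open>t - h\<close> is taken such that \<open>m\<close> does not divide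
  \<open>(t - hbar) V (t - h)\<close>, where \<open>V = P2 Dbar\<close> is vectorial because of the Study condition.\<close>

lemma transfer_factor:
  assumes "\<beta> \<noteq> 0" "P = scal (quadr \<alpha> \<beta>) * P1" "P \<noteq> 0" "\<not> quadr \<alpha> \<beta> dvd qnorm D"
    and study: "P * qconj D + D * qconj P = 0"
  shows "\<exists>h k D'. qnorm (lin_quatn h) = quadr \<alpha> \<beta> \<and> qnorm (lin_quatn k) = quadr \<alpha> \<beta>
    \<and> lin_quatn (qcnj h) * D = D' * lin_quatn k
    \<and> degree (content4 (lin_quatn (qcnj h) * P1 * qconj (lin_quatn k))) + 2 \<le> degree (content4 P)"
proof -
  let ?m = "quadr \<alpha> \<beta>"
  have prime: "prime_elem ?m" using assms(1) by (rule prime_elem_quadr)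
  define g where "g = content4 P1"
  have "P1 \<noteq> 0" using assms(2,3) by auto
  then have "g \<noteq> 0" by (simp add: g_def content4_eq_0_iff)
  have "qdvd g P1" by (simp add: qdvd_iff_content g_def)
  then obtain P2 where P2: "P1 = scal g * P2" unfolding qdvd_def by blast
  \<comment> \<open>The full content of P1 is already in g, so P2 is primitive.\<close>
  have "content4 (scal g * P2) = g" by (subst P2[symmetric]) (rule g_def[symmetric])
  then have "normalize (g * content4 P2) = g" by (simp only: content4_scal)
  then have "g * content4 P2 dvd g * 1"
    using dvd_normalize_iff[of "g * content4 P2" "g * content4 P2"] by simp
  then have "is_unit (content4 P2)"
    using \<open>g \<noteq> 0\<close> by (simp only: dvd_mult_cancel_left) simp
  have unit: "is_unit c" if "qdvd c P2" for c
    using that \<open>is_unit (content4 P2)\<close> dvd_trans by (auto simp: qdvd_iff_content)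
  define V where "V = P2 * qconj D"
  define c where "c = ?m * g"
  have P: "P = scal c * P2" by (simp add: assms(2) P2 c_def scal_mult mult.assoc)
  \<comment> \<open>Cancelling the real factor c from the Study condition leaves V + Vbar =
    0.\<close>
  have "scal c * (V + D * qconj P2) = scal c * 0"
    using study by (simp add: P V_def qconj_scal_mult scal_left_commute distrib_left mult.assoc)
  then have V0: "V + D * qconj P2 = 0"
    using \<open>g \<noteq> 0\<close> by (elim scal_cancel) (simp add: c_def)
  have "c0 V + c0 V = c0 (V + D * qconj P2)"
    by (simp add: V_def quatn_sel_mult algebra_simps)
  then have "c0 V = 0" by (simp add: V0)
  \<comment> \<open>Multiplying V by D gives the norm of D times P2; the prime m divides neither
    that norm nor the primitive P2.\<close>
  have nV: "\<not> qdvd ?m V"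
  proof
    assume "qdvd ?m V"
    then have "qdvd ?m (V * D)" by (rule qdvd_mult_right)
    also have "V * D = scal (qnorm D) * P2"
      unfolding V_def mult.assoc qconj_mult_self by (rule scal_commute)
    finally have "qdvd ?m (scal (qnorm D) * P2)" .
    then have "qdvd ?m P2"
      using assms(4) prime by (elim qdvd_prime_cancel)
    then show False using unit prime_elem_not_unit[OF prime] by blast
  qed
  obtain h where h: "qnorm (lin_quatn h) = ?m"
    and hV: "\<not> qdvd ?m (lin_quatn (qcnj h) * V * lin_quatn h)"
    using exists_conjugator[OF assms(1) nV \<open>c0 V = 0\<close>] by blast
  define L where "L = lin_quatn (qcnj h)"
  have L: "qconj L = lin_quatn h" "qnorm L = ?m"
    unfolding L_def qconj_lin[symmetric] by (simp_all add: h)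
  have "?m dvd qnorm (L * D)" by (simp add: qnorm_mult L)
  then obtain D' k where D': "L * D = D' * lin_quatn k" and k: "qnorm (lin_quatn k) = ?m"
    using right_factor[OF assms(1)] by blast
  define K where "K = lin_quatn k"
  define W where "W = L * P2 * qconj K"
  \<comment> \<open>If W = m Y, cancelling m gives L P2 = Y K. Then L V Lbar = L P2 conj(L D) = Y K
    Kbar conj(D') is a multiple of m, against the choice of h.\<close>
  have "\<not> qdvd ?m W"
  proof
    assume "qdvd ?m W"
    then obtain Y where Y: "W = scal ?m * Y" unfolding qdvd_def by blast
    have "scal ?m * (L * P2) = W * K"
      using k by (simp add: W_def K_def mult.assoc qconj_mult_self scal_commute scal_left_commute)
    also have "\<dots> = scal ?m * (Y * K)" by (simp add: Y mult.assoc)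
    finally have "L * P2 = Y * K" by (rule scal_cancel) simp
    then have "L * V * qconj L = Y * K * qconj (L * D)"
      by (simp add: V_def qconj_mult flip: mult.assoc)
    also have "\<dots> = scal ?m * (Y * qconj D')"
    proof -
      have "K * (qconj K * x) = scal ?m * x" for x
        using k by (simp add: K_def mult_qconj flip: mult.assoc)
      then show ?thesis
        by (simp add: D' qconj_mult mult.assoc scal_left_commute flip: K_def)
    qed
    finally show False using hV by (auto simp: qdvd_def L simp flip: L_def)
  qed
  \<comment> \<open>A real factor of W divides Lbar W K = m^2 P2, hence m^2. It is not divisible by
    the prime m, so it is coprime to m^2 and therefore a unit.\<close>
  have W_unit: "is_unit c" if c: "qdvd c W" for c
  proof -
    have "qdvd c (qconj L * W * K)" using c by (intro qdvd_mult_left qdvd_mult_right)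
    also have "qconj L * W * K = qconj L * L * P2 * (qconj K * K)"
      by (simp add: W_def mult.assoc)
    also have "\<dots> = scal ?m * (P2 * scal ?m)"
      using k by (simp only: qconj_mult_self L(2) K_def mult.assoc)
    also have "\<dots> = scal (?m * ?m) * P2"
      by (simp only: scal_commute[of P2] scal_mult mult.assoc)
    finally have "c dvd ?m * ?m * content4 P2"
      by (simp add: qdvd_iff_content content4_scal)
    then have "c dvd ?m * ?m"
      using \<open>is_unit (content4 P2)\<close> by (simp add: dvd_mult_unit_iff)
    moreover have "\<not> ?m dvd c"
      using c \<open>\<not> qdvd ?m W\<close> unfolding qdvd_iff_content using dvd_trans by blast
    then have "coprime ?m c" using prime_elem_imp_coprime[OF prime] by blast
    then have "coprime c (?m * ?m)" by (simp add: coprime_commute)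
    ultimately show ?thesis using coprime_absorb_left by blast
  qed
  have eq: "L * P1 * qconj K = scal g * W"
    by (simp add: P2 W_def mult.assoc scal_left_commute)
  have "is_unit (content4 W)" using W_unit[of "content4 W"] by (simp add: qdvd_iff_content)
  then have "degree (content4 (L * P1 * qconj K)) = degree g"
    using \<open>g \<noteq> 0\<close> by (auto simp: eq content4_scal degree_normalize_poly degree_mult_eq is_unit_iff_degree)
  moreover have "degree (content4 P) = degree g + 2"
    using \<open>g \<noteq> 0\<close> by (simp add: assms(2) content4_scal degree_normalize_poly degree_mult_eq flip: g_def)
  ultimately show ?thesis
    using h k D' unfolding L_def K_def by fastforce
qed

section \<open>Degree bounds and monic pairs\<close>

text \<open>A strict degree bound stated through coefficients, so that n = 0 means x = 0;
  \<open>degree\<close> does not separate zero from constants.\<close>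

definition coeffs_below :: "nat \<Rightarrow> real poly quatn \<Rightarrow> bool" where
  "coeffs_below n x \<longleftrightarrow> (\<forall>i\<ge>n. coeff (c0 x) i = 0 \<and> coeff (c1 x) i = 0
     \<and> coeff (c2 x) i = 0 \<and> coeff (c3 x) i = 0)"

lemma coeffs_below_add: "coeffs_below n x \<Longrightarrow> coeffs_below n y \<Longrightarrow> coeffs_below n (x + y)"
  by (simp add: coeffs_below_def)

lemma coeffs_below_diff: "coeffs_below n x \<Longrightarrow> coeffs_below n y \<Longrightarrow> coeffs_below n (x - y)"
  by (simp add: coeffs_below_def)

lemma coeffs_below_const: "coeffs_below n x \<Longrightarrow> coeffs_below n (x * const_quatn a)"
  "coeffs_below n x \<Longrightarrow> coeffs_below n (const_quatn a * x)"
  by (simp_all add: coeffs_below_def quatn_sel_mult mult.commute[of _ "[:_:]"])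

lemma coeffs_below_var: "coeffs_below n x \<Longrightarrow> coeffs_below (Suc n) (var_quatn * x)"
  by (auto simp: coeffs_below_def var_quatn_def coeff_pCons split: nat.splits)

lemma coeffs_below_Suc: "coeffs_below n x \<Longrightarrow> coeffs_below (Suc n) x"
  by (simp add: coeffs_below_def)

lemma coeffs_below_lin: "coeffs_below n x \<Longrightarrow> coeffs_below (Suc n) (x * lin_quatn k)"
  "coeffs_below n x \<Longrightarrow> coeffs_below (Suc n) (lin_quatn k * x)"
  unfolding lin_quatn_def right_diff_distrib left_diff_distrib var_quatn_commute
  by (intro coeffs_below_diff coeffs_below_var coeffs_below_Suc[OF coeffs_below_const(1)]
      coeffs_below_Suc[OF coeffs_below_const(2)]; assumption)+

lemma coeffs_below_quadr:
  assumes "coeffs_below (Suc (Suc n)) (scal (quadr \<alpha> \<beta>) * x)"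
  shows "coeffs_below n x"
proof -
  have "coeff f i = 0" if "\<forall>i\<ge>Suc (Suc n). coeff (quadr \<alpha> \<beta> * f) i = 0" "i \<ge> n" for f i
  proof (rule ccontr)
    assume "coeff f i \<noteq> 0"
    then have "f \<noteq> 0" "i \<le> degree f" by (auto intro: le_degree)
    then have "degree (quadr \<alpha> \<beta> * f) = 2 + degree f" by (simp add: degree_mult_eq)
    moreover have "quadr \<alpha> \<beta> * f \<noteq> 0" using \<open>f \<noteq> 0\<close> by simp
    ultimately have "coeff (quadr \<alpha> \<beta> * f) (2 + degree f) \<noteq> 0"
      by (metis leading_coeff_0_iff)
    moreover have "Suc (Suc n) \<le> 2 + degree f" using \<open>i \<le> degree f\<close> that(2) by simp
    ultimately show False using that(1) by blast
  qed
  then show ?thesis using assms by (simp add: coeffs_below_def)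
qed

text \<open>Says that P + \<epsilon> D is monic of degree n: the leading coefficient 1 has dual part
  0, so D has smaller degree.\<close>

definition monic_pair :: "nat \<Rightarrow> real poly quatn \<Rightarrow> real poly quatn \<Rightarrow> bool" where
  "monic_pair n P D \<longleftrightarrow> coeffs_below n (P - var_quatn ^ n) \<and> coeffs_below n D"

text \<open>Multiplying by the conjugate turns t - k into its real norm, which raises degrees by
  exactly two.\<close>

lemma coeffs_below_lin_cancel:
  assumes "qnorm (lin_quatn k) = quadr \<alpha> \<beta>" "coeffs_below (Suc n) (x * lin_quatn k)"
  shows "coeffs_below n x"
proof -
  have "coeffs_below (Suc (Suc n)) (x * lin_quatn k * qconj (lin_quatn k))"
    unfolding qconj_lin using assms(2) by (rule coeffs_below_lin)
  then have "coeffs_below (Suc (Suc n)) (scal (quadr \<alpha> \<beta>) * x)"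
    by (simp add: mult.assoc mult_qconj assms(1) scal_commute)
  then show ?thesis by (rule coeffs_below_quadr)
qed

lemma coeffs_below_var_power: "coeffs_below (Suc n) (var_quatn ^ n)"
proof (induction n)
  case 0
  then show ?case by (auto simp: coeffs_below_def coeff_eq_0)
qed (simp add: coeffs_below_var)

text \<open>The pair in the hypothesis is the product (P + \<epsilon> D) (t - k - \<epsilon> l). The
  bound on P comes first, since it controls the mixed term P l in the bound on D.\<close>

lemma monic_pair_right_cancel:
  assumes "qnorm (lin_quatn k) = quadr \<alpha> \<beta>"
    "monic_pair (Suc n) (P * lin_quatn k) (D * lin_quatn k - P * const_quatn l)"
  shows "monic_pair n P D"
proof -
  have "(P - var_quatn ^ n) * lin_quatn k
      = P * lin_quatn k - var_quatn ^ Suc n + var_quatn ^ n * const_quatn k"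
    by (simp add: lin_quatn_def algebra_simps var_quatn_commute)
  then have "coeffs_below (Suc n) ((P - var_quatn ^ n) * lin_quatn k)"
    using assms(2) coeffs_below_var_power[of n]
    by (auto simp: monic_pair_def intro: coeffs_below_add coeffs_below_const)
  then have P: "coeffs_below n (P - var_quatn ^ n)"
    using assms(1) coeffs_below_lin_cancel by blast
  have "coeffs_below (Suc n) P"
    using coeffs_below_add[OF coeffs_below_Suc[OF P] coeffs_below_var_power] by simp
  then have "coeffs_below (Suc n) (D * lin_quatn k - P * const_quatn l + P * const_quatn l)"
    using assms(2) unfolding monic_pair_def by (blast intro: coeffs_below_const(1) coeffs_below_add)
  then have "coeffs_below n D"
    using assms(1) coeffs_below_lin_cancel by simp
  with P show ?thesis by (simp add: monic_pair_def)
qed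

lemma monic_pair_left_lin:
  assumes "monic_pair n P D"
  shows "monic_pair (Suc n) (lin_quatn k * P) (lin_quatn k * D)"
proof -
  have "lin_quatn k * P - var_quatn ^ Suc n
      = lin_quatn k * (P - var_quatn ^ n) - const_quatn k * var_quatn ^ n"
    by (simp add: lin_quatn_def algebra_simps)
  then show ?thesis
    using assms coeffs_below_var_power[of n]
    by (auto simp: monic_pair_def intro!: coeffs_below_diff coeffs_below_lin coeffs_below_const)
qed

lemma var_quatn_power: "var_quatn ^ n = scal (monom 1 n)"
  by (induction n) (simp_all add: var_quatn_def monom_Suc flip: scal_mult)

text \<open>Only the real coordinate reaches degree n, so the leading term of its square cannot
  cancel in the norm.\<close>

lemma degree_qnorm_monic_pair:
  assumes "monic_pair n P D" "n > 0"
  shows "degree (qnorm P) > 0"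
proof -
  have low: "degree (f * f) < 2 * n" if "\<forall>i\<ge>n. coeff f i = 0" for f :: "real poly"
  proof -
    \<comment> \<open>As n > 0, n - 1 is a true predecessor and the square has degree at most 2 n -
      2.\<close>
    have "degree f \<le> n - 1" using that by (intro degree_le) auto
    then show ?thesis using degree_mult_le[of f f] assms(2) by linarith
  qed
  have c0: "coeff (c0 P) n = 1" "\<forall>i>n. coeff (c0 P) i = 0"
    using assms(1) by (auto simp: monic_pair_def coeffs_below_def var_quatn_power)
  then have "degree (c0 P) = n"
    by (metis degree_le le_antisym le_degree zero_neq_one)
  then have "degree (c0 P * c0 P) = 2 * n"
    using c0(1) assms(2) by (subst degree_mult_eq) auto
  then have "degree (qnorm P) = 2 * n"
    using assms(1) low[of "c1 P"] low[of "c2 P"] low[of "c3 P"]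
    by (simp add: qnorm_def degree_add_eq_left monic_pair_def coeffs_below_def var_quatn_power)
  then show ?thesis using assms(2) by simp
qed

section \<open>The induction\<close>

definition has_rotation_factorization :: "real poly quatn dualn \<Rightarrow> nat \<Rightarrow> bool" where
  "has_rotation_factorization M d \<longleftrightarrow> (\<exists>Q hs. degree Q \<le> d \<and> (\<forall>h\<in>set hs. rotation_elem h)
      \<and> Dualn (scal Q) 0 * M = prod_list (map lin_dualn hs))"

text \<open>Splitting off a right factor lowers n and does not raise the degree of the content. A
  transfer keeps n and lowers that degree by at least two, which pays for the factor m in Q.\<close>

lemma factorization:
  assumes "monic_pair n P D" "P * qconj D + D * qconj P = 0" "\<And>r. poly (qnorm P) r \<noteq> 0"
  shows "has_rotation_factorization (Dualn P D) (degree (content4 P))"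
  using assms
proof (induction "n + degree (content4 P)" arbitrary: n P D rule: less_induct)
  case less
  show ?case
  proof (cases n)
    case 0
    \<comment> \<open>Monic of degree 0 means equal to 1: the empty product with Q = 1.\<close>
    then have "P = 1" "D = 0"
      using less.prems(1)
      by (auto simp: monic_pair_def coeffs_below_def poly_eq_iff intro!: quatn_eqI)
    then have "Dualn (scal 1) 0 * Dualn P D = prod_list (map lin_dualn [])"
      by (simp add: one_dualn_def flip: one_dualn_def)
    then show ?thesis unfolding has_rotation_factorization_def
      by (intro exI[of _ 1] exI[of _ "[]"]) simp
  next
    case (Suc n')
    have "degree (qnorm P) > 0"
      using degree_qnorm_monic_pair less.prems(1) Suc by blast
    then obtain \<alpha> \<beta> where b: "\<beta> \<noteq> 0" and m: "quadr \<alpha> \<beta> dvd qnorm P"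
      using exists_quadr_factor less.prems(3) by blast
    let ?m = "quadr \<alpha> \<beta>"
    have P0: "P \<noteq> 0" using less.prems(3)[of 0] by (auto simp: qnorm_def)
    show ?thesis
    proof (cases "qdvd ?m P \<and> \<not> ?m dvd qnorm D")
      \<comment> \<open>Either m does not divide P, or it divides both P and the norm of D; in both
        cases a factor t - k - \<epsilon> l splits off on the right.\<close>
      case False
      obtain P' D' k l where P': "P = P' * lin_quatn k"
        and D': "D = D' * lin_quatn k - P' * const_quatn l"
        and k: "qnorm (lin_quatn k) = ?m"
        and l: "l + qcnj l = 0" "k * qcnj l + l * qcnj k = 0"
      proof (cases "qdvd ?m P")
        case True
        then have "?m dvd qnorm D" using False by blast
        then obtain D' k where D': "D = D' * lin_quatn k" and k: "qnorm (lin_quatn k) = ?m"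
          using right_factor[OF b] by blast
        obtain P1 where P1: "P = scal ?m * P1" using True unfolding qdvd_def by blast
        \<comment> \<open>The right factor t - k of D also divides m = (t - kbar) (t - k), hence P;
          so l = 0.\<close>
        have "P = P1 * qconj (lin_quatn k) * lin_quatn k"
          by (simp add: P1 mult.assoc qconj_mult_self k scal_commute)
        with D' k show ?thesis
          by (intro that[of "P1 * qconj (lin_quatn k)" k D' 0]) simp_all
      qed (use dual_right_factor[OF b m _ less.prems(2)] in blast)
      define K where "K = lin_quatn k"
      define l' where "l' = const_quatn l"
      have KK: "K * (qconj K * x) = scal ?m * x" for x
        using k by (simp add: K_def mult_qconj flip: mult.assoc)
      \<comment> \<open>The split-off factor satisfies the Study condition itself, so that of P and
        D is m times that of P' and D'.\<close>
      have Kl: "K * qconj l' + l' * qconj K = 0"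
      proof -
        have "K * qconj l' + l' * qconj K
            = var_quatn * const_quatn (l + qcnj l) - const_quatn (k * qcnj l + l * qcnj k)"
          by (simp add: K_def lin_quatn_def l'_def qconj_diff qconj_const
              const_quatn_add const_quatn_mult algebra_simps var_quatn_commute)
        then show ?thesis by (simp add: l)
      qed
      have "P * qconj D + D * qconj P
          = scal ?m * (P' * qconj D' + D' * qconj P') - P' * (K * qconj l' + l' * qconj K) * qconj P'"
        by (simp add: P' D' qconj_diff qconj_mult algebra_simps KK scal_left_commute
            flip: K_def l'_def)
      then have "scal ?m * (P' * qconj D' + D' * qconj P') = scal ?m * 0"
        using less.prems(2) by (simp add: Kl)
      then have study': "P' * qconj D' + D' * qconj P' = 0"
        by (rule scal_cancel) simp
      have monic': "monic_pair n' P' D'"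
        using less.prems(1) unfolding P' D' Suc by (rule monic_pair_right_cancel[OF k])
      have roots': "poly (qnorm P') r \<noteq> 0" for r
        using less.prems(3)[of r] by (auto simp: P' qnorm_mult)
      have "qdvd (content4 P') P"
        unfolding P' by (intro qdvd_mult_right) (simp add: qdvd_iff_content)
      \<comment> \<open>A real factor of the left factor P' is one of P.\<close>
      then have deg: "degree (content4 P') \<le> degree (content4 P)"
        using P0 by (intro dvd_imp_degree_le) (simp_all add: qdvd_iff_content content4_eq_0_iff)
      then have "has_rotation_factorization (Dualn P' D') (degree (content4 P'))"
        using less.hyps[OF _ monic' study' roots'] Suc by simp
      then obtain Q hs where Q: "degree Q \<le> degree (content4 P')" "\<forall>h\<in>set hs. rotation_elem h"
        "Dualn (scal Q) 0 * Dualn P' D' = prod_list (map lin_dualn hs)"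
        unfolding has_rotation_factorization_def by blast
      have M: "Dualn P D = Dualn P' D' * lin_dualn (DQ k l)"
        by (simp add: times_dualn_def lin_dualn_def lin_quatn_def[symmetric] P' D')
      have "rotation_elem (DQ k l)"
        using l lin_not_real[OF k b] by (simp add: rotation_elem_def)
      moreover have "Dualn (scal Q) 0 * Dualn P D = prod_list (map lin_dualn (hs @ [DQ k l]))"
        by (simp add: M Q(3) flip: mult.assoc)
      ultimately show ?thesis
        using Q(1,2) deg unfolding has_rotation_factorization_def
        by (intro exI[of _ Q] exI[of _ "hs @ [DQ k l]"]) auto
    next
      case True
      then obtain P1 where P1: "P = scal ?m * P1" unfolding qdvd_def by blast
      obtain h k D' where h: "qnorm (lin_quatn h) = ?m" and k: "qnorm (lin_quatn k) = ?m"
        and D': "lin_quatn (qcnj h) * D = D' * lin_quatn k"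
        and deg: "degree (content4 (lin_quatn (qcnj h) * P1 * qconj (lin_quatn k))) + 2
          \<le> degree (content4 P)"
        using transfer_factor[OF b P1 P0 _ less.prems(2)] True by blast
      define H where "H = lin_quatn h"
      define K where "K = lin_quatn k"
      define P' where "P' = qconj H * P1 * qconj K"
      have HK: "H * (qconj H * x) = scal ?m * x" "K * (qconj K * x) = scal ?m * x"
        "qconj K * K = scal ?m" for x
        using h k by (simp_all add: H_def K_def mult_qconj qconj_mult_self flip: mult.assoc)
      have D'': "qconj H * D = D' * K" using D' by (simp add: H_def K_def qconj_lin)
      \<comment> \<open>Here m = Kbar K supplies the right factor K, so primal and dual part share
        the same K.\<close>
      have P'': "qconj H * P = P' * K"
        by (simp add: P'_def P1 mult.assoc HK scal_left_commute scal_commute)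
      have "scal ?m * (P' * qconj D' + D' * qconj P')
          = P' * K * qconj (D' * K) + D' * K * qconj (P' * K)"
        by (simp add: qconj_mult mult.assoc HK scal_left_commute distrib_left)
      also have "\<dots> = qconj H * (P * qconj D + D * qconj P) * H"
        by (simp add: qconj_mult mult.assoc distrib_left distrib_right flip: P'' D'')
      also have "\<dots> = scal ?m * 0" by (simp add: less.prems(2))
      finally have study': "P' * qconj D' + D' * qconj P' = 0" by (rule scal_cancel) simp
      \<comment> \<open>The left factor raises the degree by one and cancelling K lowers it
        again.\<close>
      have "monic_pair (Suc n) (P' * K) (D' * K)"
        unfolding P''[symmetric] D''[symmetric] unfolding H_def qconj_lin
        by (rule monic_pair_left_lin) (rule less.prems(1))
      then have monic': "monic_pair n P' D'"
        using monic_pair_right_cancel[OF k, of n P' D' 0] by (simp add: K_def)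
      \<comment> \<open>H and K have the same norm m, so P' has the norm of P and boundedness is
        inherited.\<close>
      have "?m * qnorm P' = ?m * qnorm P"
        using arg_cong[OF P'', of qnorm] h k by (simp add: qnorm_mult H_def K_def mult.commute)
      then have roots': "poly (qnorm P') r \<noteq> 0" for r
        using less.prems(3)[of r] by simp
      have deg': "degree (content4 P') + 2 \<le> degree (content4 P)"
        using deg by (simp add: P'_def H_def K_def qconj_lin)
      then have "has_rotation_factorization (Dualn P' D') (degree (content4 P'))"
        using less.hyps[OF _ monic' study' roots'] by simp
      then obtain Q hs where Q: "degree Q \<le> degree (content4 P')" "\<forall>h\<in>set hs. rotation_elem h"
        "Dualn (scal Q) 0 * Dualn P' D' = prod_list (map lin_dualn hs)"
        unfolding has_rotation_factorization_def by blast
      have lins: "lin_dualn (DQ h 0) = Dualn H 0" "lin_dualn (DQ k 0) = Dualn K 0"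
        by (simp_all add: lin_dualn_def lin_quatn_def H_def K_def)
      \<comment> \<open>Q is central and H Hbar = m, so m Q M = H Q (Hbar M) = H (Q M') K.\<close>
      have HQ: "H * scal Q * (qconj H * x) = scal (?m * Q) * x" for x
        by (simp add: mult.commute[of ?m] scal_mult scal_commute[of H] mult.assoc HK)
      have "scal (?m * Q) * P = H * scal Q * P' * K" "scal (?m * Q) * D = H * scal Q * D' * K"
        using HQ[of P] HQ[of D] by (simp_all add: P'' D'' mult.assoc)
      then have "Dualn (scal (?m * Q)) 0 * Dualn P D
          = Dualn (H * scal Q * P' * K) (H * scal Q * D' * K)"
        by (simp add: times_dualn_def)
      also have "\<dots> = Dualn H 0 * (Dualn (scal Q) 0 * Dualn P' D') * Dualn K 0"
        by (simp add: times_dualn_def mult.assoc)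
      also have "\<dots> = prod_list (map lin_dualn (DQ h 0 # hs @ [DQ k 0]))"
        by (simp add: Q(3) lins mult.assoc)
      finally have "Dualn (scal (?m * Q)) 0 * Dualn P D
          = prod_list (map lin_dualn (DQ h 0 # hs @ [DQ k 0]))" .
      moreover have "rotation_elem (DQ h 0)" "rotation_elem (DQ k 0)"
        using lin_not_real[OF h b] lin_not_real[OF k b] by (simp_all add: rotation_elem_def)
      moreover have "degree (?m * Q) \<le> degree (content4 P)"
        using Q(1) deg' degree_mult_le[of ?m Q] by simp
      ultimately show ?thesis
        using Q(2) unfolding has_rotation_factorization_def
        by (intro exI[of _ "?m * Q"] exI[of _ "DQ h 0 # hs @ [DQ k 0]"]) auto
    qed
  qed
qed

section \<open>Return to the original notions\<close>

lemma qpeval_sel: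
  "qre (qpeval p r) = poly (map_poly qre p) r" "qi (qpeval p r) = poly (map_poly qi p) r"
  "qj (qpeval p r) = poly (map_poly qj p) r" "qk (qpeval p r) = poly (map_poly qk p) r"
proof -
  have poly: "poly (map_poly f p) r = (\<Sum>i\<le>degree p. r ^ i * f (coeff p i))"
    if "f 0 = 0" for f :: "quat \<Rightarrow> real"
  proof -
    have "i \<le> degree (map_poly f p)" if "f (coeff p i) \<noteq> 0" for i
      using that \<open>f 0 = 0\<close> by (intro le_degree) (simp add: coeff_map_poly)
    \<comment> \<open>A coordinate polynomial may have smaller degree than p; the sum is extended by
      zero terms.\<close>
    then show ?thesis
      using that map_poly_degree_leq[of f p]
      by (subst poly_altdef, subst sum.mono_neutral_left[of "{..degree p}" "{..degree (map_poly f p)}"])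
        (auto simp: coeff_map_poly mult.commute)
  qed
  have sum: "f (sum g A) = (\<Sum>i\<in>A. f (g i))"
    if "f 0 = 0" "\<And>x y. f (x + y) = f x + f y"
    for f :: "quat \<Rightarrow> real" and g and A :: "nat set"
    using that by (induction A rule: infinite_finite_induct) simp_all
  show "qre (qpeval p r) = poly (map_poly qre p) r" "qi (qpeval p r) = poly (map_poly qi p) r"
    "qj (qpeval p r) = poly (map_poly qj p) r" "qk (qpeval p r) = poly (map_poly qk p) r"
    by (simp_all add: qpeval_def poly sum quat_sel_mult)
qed

theorem theorem4:
  fixes M :: "dquat poly" and R :: "real poly"
  assumes "motion_poly M"
    and "monic_dpoly M"
    and "bounded_dpoly M"
    and "greatest_real_factor R (primal M)"
  shows "\<exists>(Q :: real poly) (hs :: dquat list).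
           degree Q \<le> degree R \<and>
           (\<forall>h\<in>set hs. rotation_elem h) \<and>
           pmult (map_poly dq_of_real Q) M = pprod_list (map lin_poly hs)"
proof -
  define P where "P = poly_quatn (primal M)"
  define D where "D = poly_quatn (dualpart M)"
  have study: "P * qconj D + D * qconj P = 0"
    using arg_cong[of _ _ poly_quatn, OF conjunct1[OF assms(1)[unfolded motion_poly_def]]]
    by (simp add: P_def D_def poly_quatn_add poly_quatn_pmult poly_quatn_cnj)
  have roots: "poly (qnorm P) r \<noteq> 0" for r
  proof
    assume "poly (qnorm P) r = 0"
    then have "qre (qpeval (primal M) r) * qre (qpeval (primal M) r)
      + qi (qpeval (primal M) r) * qi (qpeval (primal M) r)
      + qj (qpeval (primal M) r) * qj (qpeval (primal M) r)
      + qk (qpeval (primal M) r) * qk (qpeval (primal M) r) = 0"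
      by (simp add: qnorm_def P_def qpeval_sel)
    then have "qpeval (primal M) r = 0"
      by (intro quat_eqI; simp; smt (verit) zero_le_square mult_eq_0_iff)
    then show False using assms(3) by (simp add: bounded_dpoly_def)
  qed
  have monic: "monic_pair (degree M) P D"
  proof -
    have "coeff M i = (if i = degree M then 1 else 0)" if "i \<ge> degree M" for i
      using that assms(2) by (auto simp: monic_dpoly_def intro: coeff_eq_0)
    then show ?thesis
      by (auto simp: monic_pair_def coeffs_below_def P_def D_def var_quatn_power coeff_map_poly
          primal_def dualpart_def)
  qed
  have "P \<noteq> 0" using roots[of 0] by (auto simp: qnorm_def)
  then have c0: "content4 P \<noteq> 0" by (simp add: content4_eq_0_iff)
  have "degree (content4 P) \<le> degree R"
  proof -
    \<comment> \<open>Made monic, because \<open>greatest_real_factor\<close> compares only monic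
      divisors.\<close>
    define c where "c = smult (inverse (lead_coeff (content4 P))) (content4 P)"
    have "lead_coeff c = 1" "degree c = degree (content4 P)" using c0 by (simp_all add: c_def)
    moreover have "c dvd content4 P" using c0 by (simp add: c_def smult_dvd_iff)
    then have "real_divides c (primal M)"
      by (simp add: real_divides_iff qdvd_iff_content P_def)
    ultimately show ?thesis using assms(4) by (metis greatest_real_factor_def)
  qed
  moreover obtain Q hs where Q: "degree Q \<le> degree (content4 P)" "\<forall>h\<in>set hs. rotation_elem h"
    "Dualn (scal Q) 0 * Dualn P D = prod_list (map lin_dualn hs)"
    using factorization[OF monic study roots] unfolding has_rotation_factorization_def by blast
  have "poly_dualn M = Dualn P D" by (simp add: poly_dualn_def P_def D_def)
  then have "poly_dualn (pmult (map_poly dq_of_real Q) M) = poly_dualn (pprod_list (map lin_poly hs))"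
    using Q(3) by (simp add: poly_dualn_pmult poly_dualn_of_real poly_dualn_prod)
  then have "pmult (map_poly dq_of_real Q) M = pprod_list (map lin_poly hs)"
    by (rule poly_dualn_inj)
  ultimately show ?thesis using Q(1,2) le_trans by blast
qed

end
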